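(* Let $G=G_{2,f}$ be a non-torsion Šunić group acting on the binary rooted tree $T$, let $q\ge 3$ be an odd number, and let $b\in B$ be such that $\psi(b)=(a,b)$. Then the subgroup $H(q)=\langle (ab)^q,B\rangle$ is conjugate to $G$ in $\mathrm{Aut}\,T$.
   Context: Let $X=\{\mathbf 0,\mathbf 1\}$ and let $T$ be the binary rooted tree with vertex set $X^*$ (finite words; $w$ is joined to $wx$ for $x\in X$). $\mathrm{Aut}\,T$ acts on the left. For $g\in\mathrm{Aut}\,T$ and a vertex $v$, $g_v\in \mathrm{Aut}\,T$ is the unique automorphism with $g(vw)=g(v)g_v(w)$ for all $w$; if $g$ fixes the first level $X$ pointwise, write $\psi(g)=(g_{\mathbf 0},g_{\mathbf 1})$. Šunić groups on the binary tree: let $f(x)=x^m+a_{m-1}x^{m-1}+\dots+a_1x+a_0\in\mathbb F_2[x]$ with $m\ge 1$, $a_0\neq 0$. Let $B\cong(\mathbb Z/2)^m$ be written multiplicatively with basis $b_0,\dots,b_{m-1}$; let $\rho\colon B\to B$ be the automorphism with $\rho(b_i)=b_{i+1}$ for $0\le i\le m-2$ and $\rho(b_{m-1})=b_0^{-a_0}b_1^{-a_1}\cdots b_{m-1}^{-a_{m-1}}$. Let $A=\langle a\rangle$ be of order 2 and $\omega\colon B\to A$ the homomorphism with $\omega(b_i)=1$ for $i\le m-2$ and $\omega(b_{m-1})=a$. Then $a$ acts on $T$ by swapping the first letter ($a(\mathbf 0w)=\mathbf 1w$, $a(\mathbf 1w)=\mathbf 0w$), and $x\in B$ acts recursively by fixing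 the first level with $\psi(x)=(\omega(x),\rho(x))$. These actions are faithful, and $G_{2,f}:=\langle A\cup B\rangle\le\mathrm{Aut}\,T$. Non-torsion means containing an element of infinite order; in that case an element $b\in B$ with $\psi(b)=(a,b)$ exists. *)

theory Defs
  imports "HOL-Algebra.Algebra" "HOL-Computational_Algebra.Polynomial" "HOL-Library.Z2"
begin

text \<open>
  Vertices of the rooted binary tree are words over the alphabet \<open>{False, True}\<close>; \<open>False\<close> is the
  letter 0 and \<open>True\<close> the letter 1.
\<close>

type_synonym vertex = "bool list"

definition tree_adj :: "vertex \<Rightarrow> vertex \<Rightarrow> bool" where
  "tree_adj u v \<longleftrightarrow> (\<exists>x. v = u @ [x]) \<or> (\<exists>x. u = v @ [x])"

definition tree_auts :: "(vertex \<Rightarrow> vertex) set" where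
  "tree_auts = {g. bij g \<and> g [] = [] \<and> (\<forall>u v. tree_adj (g u) (g v) \<longleftrightarrow> tree_adj u v)}"

text \<open>The product is composition, since automorphisms act on the left.\<close>

definition Aut_T :: "(vertex \<Rightarrow> vertex) monoid" where
  "Aut_T = \<lparr>carrier = tree_auts, monoid.mult = (\<circ>), one = id\<rparr>"

definition section_at :: "(vertex \<Rightarrow> vertex) \<Rightarrow> vertex \<Rightarrow> (vertex \<Rightarrow> vertex)" where
  "section_at g v = (THE h. h \<in> carrier Aut_T \<and> (\<forall>w. g (v @ w) = g v @ h w))"

definition fixes_first_level :: "(vertex \<Rightarrow> vertex) \<Rightarrow> bool" where
  "fixes_first_level g \<longleftrightarrow> (\<forall>x. g [x] = [x])"

text \<open>Only meaningful for automorphisms that fix the first level pointwise.\<close>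

definition psi :: "(vertex \<Rightarrow> vertex) \<Rightarrow> (vertex \<Rightarrow> vertex) \<times> (vertex \<Rightarrow> vertex)" where
  "psi g = (section_at g [False], section_at g [True])"

text \<open>
  With \<open>m = degree f\<close>, an element \<open>b\<^sub>0\<^bsup>v 0\<^esup> \<cdots> b\<^bsub>m-1\<^esub>\<^bsup>v (m-1)\<^esup>\<close> of the abstract group \<open>B\<close> is represented
  by its exponent vector \<open>v\<close>, extended by zero; multiplication in \<open>B\<close> is pointwise addition.
\<close>

definition vecB :: "bit poly \<Rightarrow> (nat \<Rightarrow> bit) set" where
  "vecB f = {v. \<forall>i \<ge> degree f. v i = 0}"

definition basisB :: "nat \<Rightarrow> (nat \<Rightarrow> bit)" where
  "basisB i = (\<lambda>j. if j = i then 1 else 0)"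

definition rho :: "bit poly \<Rightarrow> (nat \<Rightarrow> bit) \<Rightarrow> (nat \<Rightarrow> bit)" where
  "rho f v = (\<lambda>i. if i < degree f
     then (case i of 0 \<Rightarrow> 0 | Suc j \<Rightarrow> v j) - coeff f i * v (degree f - 1)
     else 0)"

fun swapT :: "vertex \<Rightarrow> vertex" where
  "swapT [] = []"
| "swapT (x # w) = (\<not> x) # w"

text \<open>The group \<open>A\<close> of order 2 is identified with \<open>{id, swapT}\<close>.\<close>

definition omega :: "bit poly \<Rightarrow> (nat \<Rightarrow> bit) \<Rightarrow> (vertex \<Rightarrow> vertex)" where
  "omega f v = (if v (degree f - 1) = 0 then id else swapT)"

fun actB :: "bit poly \<Rightarrow> (nat \<Rightarrow> bit) \<Rightarrow> vertex \<Rightarrow> vertex" where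
  "actB f v [] = []"
| "actB f v (False # w) = False # omega f v w"
| "actB f v (True # w) = True # actB f (rho f v) w"

definition imgB :: "bit poly \<Rightarrow> (vertex \<Rightarrow> vertex) set" where
  "imgB f = actB f ` vecB f"

definition sunic_group :: "bit poly \<Rightarrow> (vertex \<Rightarrow> vertex) set" where
  "sunic_group f = generate Aut_T (insert swapT (imgB f))"

definition non_torsion :: "('a, 'b) monoid_scheme \<Rightarrow> 'a set \<Rightarrow> bool" where
  "non_torsion G H \<longleftrightarrow> (\<exists>g \<in> H. \<forall>n::nat. n > 0 \<longrightarrow> g [^]\<^bsub>G\<^esub> n \<noteq> \<one>\<^bsub>G\<^esub>)"

definition conjugate_in :: "('a, 'b) monoid_scheme \<Rightarrow> 'a set \<Rightarrow> 'a set \<Rightarrow> bool" where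
  "conjugate_in G H K \<longleftrightarrow> (\<exists>t \<in> carrier G. t <#\<^bsub>G\<^esub> H #>\<^bsub>G\<^esub> inv\<^bsub>G\<^esub> t = K)"


text \<open>The remaining facts check the encoding against the defining properties of the action.\<close>

lemma group_Aut_T: "group Aut_T"
proof (rule groupI)
  fix g assume g: "g \<in> carrier Aut_T"
  then have b: "bij g" and r: "g [] = []" and ad: "\<And>u v. tree_adj (g u) (g v) \<longleftrightarrow> tree_adj u v"
    by (auto simp: Aut_T_def tree_auts_def)
  have "tree_adj (inv_into UNIV g u) (inv_into UNIV g v) \<longleftrightarrow> tree_adj u v" for u v
    using ad[of "inv_into UNIV g u" "inv_into UNIV g v"] b by (simp add: bij_is_surj surj_f_inv_f)
  moreover have "inv_into UNIV g [] = []"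
    using b r by (metis bij_inv_eq_iff)
  ultimately have "inv_into UNIV g \<in> carrier Aut_T"
    using b by (simp add: Aut_T_def tree_auts_def bij_imp_bij_inv)
  moreover have "inv_into UNIV g \<otimes>\<^bsub>Aut_T\<^esub> g = \<one>\<^bsub>Aut_T\<^esub>"
    using b by (simp add: Aut_T_def bij_is_inj)
  ultimately show "\<exists>h \<in> carrier Aut_T. h \<otimes>\<^bsub>Aut_T\<^esub> g = \<one>\<^bsub>Aut_T\<^esub>" by blast
qed (auto simp: Aut_T_def tree_auts_def bij_comp o_assoc)

lemma section_at_eqI:
  assumes "h \<in> carrier Aut_T" and "\<And>w. g (v @ w) = g v @ h w"
  shows "section_at g v = h"
  unfolding section_at_def using assms by (intro the_equality) (auto intro!: ext)

lemma aut_of_involutionI: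
  assumes inv: "\<And>u. g (g u) = u" and root: "g [] = []"
    and child: "\<And>u x. \<exists>y. g (u @ [x]) = g u @ [y]"
  shows "g \<in> carrier Aut_T"
proof -
  have "tree_adj u v \<Longrightarrow> tree_adj (g u) (g v)" for u v
    unfolding tree_adj_def using child by metis
  then have "tree_adj (g u) (g v) \<longleftrightarrow> tree_adj u v" for u v
    using inv by metis
  then show ?thesis
    using inv root by (simp add: Aut_T_def tree_auts_def involuntory_imp_bij)
qed

lemma swapT_swapT: "swapT (swapT w) = w"
  by (cases w) auto

lemma swapT_child: "\<exists>y. swapT (u @ [x]) = swapT u @ [y]"
  by (cases u) auto

lemma swapT_in_Aut: "swapT \<in> carrier Aut_T"
  by (rule aut_of_involutionI) (auto simp: swapT_swapT swapT_child)

lemma omega_in_Aut: "omega f v \<in> carrier Aut_T"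
  using swapT_in_Aut group.is_monoid[OF group_Aut_T, THEN monoid.one_closed]
  by (auto simp: omega_def Aut_T_def)

lemma actB_actB: "actB f v (actB f v w) = w"
  by (induction f v w rule: actB.induct) (auto simp: omega_def swapT_swapT)

lemma actB_child: "\<exists>y. actB f v (u @ [x]) = actB f v u @ [y]"
proof (induction f v u rule: actB.induct)
  case (1 f v) show ?case by (cases x) (auto simp: omega_def)
next
  case (2 f v w) show ?case by (auto simp: omega_def swapT_child)
qed auto

lemma actB_in_Aut: "actB f v \<in> carrier Aut_T"
  by (rule aut_of_involutionI) (auto simp: actB_actB actB_child)

lemma actB_fixes_first_level: "fixes_first_level (actB f v)"
proof -
  have "actB f v [x] = [x]" for x by (cases x) (auto simp: omega_def)
  then show ?thesis by (simp add: fixes_first_level_def)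
qed

lemma psi_actB: "psi (actB f v) = (omega f v, actB f (rho f v))"
proof -
  have "actB f v [False] = [False]" by (simp add: omega_def)
  then show ?thesis
    unfolding psi_def by (auto intro!: section_at_eqI simp: omega_in_Aut actB_in_Aut)
qed

lemma rho_in_vecB: "rho f v \<in> vecB f"
  by (simp add: rho_def vecB_def)

lemma rho_add: "rho f (\<lambda>i. v i + w i) = (\<lambda>i. rho f v i + rho f w i)"
proof -
  have "x + y - c * (s + t) = (x - c * s) + (y - c * t)" for x y c s t :: bit
    by (simp only: distrib_left add_diff_add)
  from this[of 0 0] this show ?thesis
    by (intro ext) (simp only: rho_def add_0 split: nat.split if_split, blast)
qed

lemma rho_basisB: "Suc i < degree f \<Longrightarrow> rho f (basisB i) = basisB (Suc i)"
  by (rule ext) (auto simp: rho_def basisB_def split: nat.split)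

lemma rho_basisB_last:
  "degree f \<ge> 1 \<Longrightarrow> rho f (basisB (degree f - 1)) = (\<lambda>i. if i < degree f then - coeff f i else 0)"
  by (rule ext) (auto simp: rho_def basisB_def split: nat.split)

lemma omega_add: "omega f (\<lambda>i. v i + w i) = omega f v \<circ> omega f w"
  by (rule ext) (auto simp: omega_def swapT_swapT bit_not_zero_iff)

lemma omega_basisB: "Suc i < degree f \<Longrightarrow> omega f (basisB i) = id"
  by (auto simp: omega_def basisB_def)

lemma omega_basisB_last: "omega f (basisB (degree f - 1)) = swapT"
  by (simp add: omega_def basisB_def)

lemma actB_add: "actB f (\<lambda>i. v i + w i) = actB f v \<circ> actB f w"
proof -
  have "actB f (\<lambda>i. v i + w i) u = actB f v (actB f w u)" for u
  proof (induction u arbitrary: v w)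
    case (Cons x u) then show ?case by (cases x) (simp_all only: actB.simps omega_add rho_add o_apply)
  qed (simp only: actB.simps)
  then show ?thesis by auto
qed

lemma omega_cong: "actB f v = actB f w \<Longrightarrow> omega f v = omega f w \<and> actB f (rho f v) = actB f (rho f w)"
  using psi_actB[of f v] psi_actB[of f w] by simp

lemma actB_faithful:
  assumes "degree f \<ge> 1"
  shows "inj_on (actB f) (vecB f)"
proof (rule inj_onI)
  fix v w assume v: "v \<in> vecB f" and w: "w \<in> vecB f" and eq: "actB f v = actB f w"
  have top: "v (degree f - 1) = w (degree f - 1)" if "actB f v = actB f w" for v w
  proof -
    have "swapT [True] \<noteq> id [True]" by simp
    then have "swapT \<noteq> id" by metis
    then show ?thesis using omega_cong[OF that] by (auto simp: omega_def bit_not_zero_iff split: if_splits)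
  qed
  have "actB f v = actB f w \<Longrightarrow> k < degree f \<Longrightarrow> v (degree f - 1 - k) = w (degree f - 1 - k)" for k v w
  proof (induction k arbitrary: v w)
    case 0 then show ?case using top by simp
  next
    case (Suc k)
    let ?i = "degree f - 1 - Suc k"
    have i: "degree f - 1 - k = Suc ?i" "Suc ?i < degree f" using Suc.prems by auto
    have "rho f v (Suc ?i) = rho f w (Suc ?i)"
      using Suc.IH[of "rho f v" "rho f w"] omega_cong[OF Suc.prems(1)] Suc.prems(2) i by simp
    then have "v ?i - coeff f (Suc ?i) * v (degree f - 1) = w ?i - coeff f (Suc ?i) * v (degree f - 1)"
      by (simp only: rho_def i(2) if_True nat.case top[OF Suc.prems(1)])
    then show ?case by (metis diff_add_cancel)
  qed
  note this[OF eq]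
  then have "v i = w i" if "i < degree f" for i
    using that \<open>\<And>k. k < degree f \<Longrightarrow> v (degree f - 1 - k) = w (degree f - 1 - k)\<close>[of "degree f - 1 - i"] by simp
  moreover have "v i = w i" if "\<not> i < degree f" for i
    using that v w by (simp add: vecB_def)
  ultimately show "v = w" by blast
qed

end

theory Submission
  imports Defs
begin

text \<open>
  Write \<open>q = 2k + 1\<close>, \<open>a\<close> for the swap, and let \<open>g\<close> be the automorphism fixing the first level with
  \<open>\<psi>(g) = ((ba)\<^sup>k g, g)\<close>. From \<open>\<psi>(abab) = (ba, ab)\<close> one reads off \<open>g a = (ab)\<^sup>2\<^sup>k a g\<close>. By induction
  on the level, \<open>g\<close> then centralises \<open>B\<close>: on the right subtree this is the induction hypothesis, and on the
  left subtree it says that \<open>(ba)\<^sup>k g\<close> commutes with \<open>a\<close>, which is the formula for \<open>g a\<close> again. Hence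
  \<open>g (ab) = (ab)\<^sup>q g\<close>, so conjugation by \<open>g\<close> carries \<open>\<langle>ab, B\<rangle> = \<langle>a, B\<rangle>\<close> onto \<open>\<langle>(ab)\<^sup>q, B\<rangle>\<close>.
\<close>

text \<open>Sending children to children also reflects the child relation: if
  \<open>g v = g u @ [y]\<close>, then \<open>v\<close> without its last letter has image
  \<open>g u\<close>, so by injectivity it is \<open>u\<close>.\<close>

lemma aut_of_bijI:
  assumes bij: "bij g" and root: "g [] = []"
    and child: "\<And>u x. \<exists>y. g (u @ [x]) = g u @ [y]"
  shows "g \<in> carrier Aut_T"
proof -
  have child_iff: "(\<exists>y. g v = g u @ [y]) \<longleftrightarrow> (\<exists>x. v = u @ [x])" for u v
  proof
    assume "\<exists>y. g v = g u @ [y]"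
    then obtain y where y: "g v = g u @ [y]" ..
    then have "v \<noteq> []" using root by auto
    then obtain v' x where v: "v = v' @ [x]" by (metis rev_exhaust)
    then have "g v' = g u" using child[of v' x] y by auto
    then show "\<exists>x. v = u @ [x]" using v bij by (auto dest: bij_is_inj injD)
  qed (use child in blast)
  then show ?thesis
    using bij root by (simp add: Aut_T_def tree_auts_def tree_adj_def child_iff)
qed

text \<open>Adjacency alone might let a child move up. But the only upward neighbour of
  \<open>g (u @ [z])\<close> is \<open>g u\<close> by induction, and injectivity forbids hitting
  \<open>g u\<close> again.\<close>

lemma aut_child:
  assumes "g \<in> carrier Aut_T"
  shows "\<exists>y. g (u @ [x]) = g u @ [y]"
proof -
  have inj: "inj g" and root: "g [] = []" and adj: "\<And>u v. tree_adj (g u) (g v) \<longleftrightarrow> tree_adj u v"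
    using assms by (auto simp: Aut_T_def tree_auts_def bij_is_inj)
  have step: "tree_adj (g u) (g (u @ [x]))" for u x
    unfolding adj by (auto simp: tree_adj_def)
  show ?thesis
  proof (induction u arbitrary: x rule: rev_induct)
    case Nil
    then show ?case using step[of "[]" x] by (simp add: tree_adj_def root)
  next
    case (snoc z u)
    have "g ((u @ [z]) @ [x]) \<noteq> g u"
      using inj by (simp add: inj_eq)
    then show ?case
      using snoc[of z] step[of "u @ [z]" x] unfolding tree_adj_def by (metis append1_eq_conv)
  qed
qed

lemma length_aut:
  assumes "g \<in> carrier Aut_T"
  shows "length (g w) = length w"
proof (induction w rule: rev_induct)
  case Nil
  then show ?case using assms by (simp add: Aut_T_def tree_auts_def)
next
  case (snoc x w)
  then show ?case using aut_child[OF assms, of w x] by auto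
qed

lemma Aut_T_pow: "g [^]\<^bsub>Aut_T\<^esub> n = g ^^ n" for n :: nat
  by (induction n) (simp_all add: Aut_T_def nat_pow_def funpow_Suc_right del: funpow.simps(2))

lemma Aut_T_funpow: "g \<in> carrier Aut_T \<Longrightarrow> g ^^ n \<in> carrier Aut_T"
  using monoid.nat_pow_closed[OF group.is_monoid[OF group_Aut_T]] by (metis Aut_T_pow)

lemma (in group) conjugate_generate:
  assumes t: "t \<in> carrier G" and K: "K \<subseteq> carrier G"
  shows "t <# generate G K #> inv t = generate G ((\<lambda>x. t \<otimes> x \<otimes> inv t) ` K)"
proof -
  have "group_hom G G (\<lambda>x. t \<otimes> x \<otimes> inv t)"
    using t by unfold_locales (auto simp: hom_def m_assoc inv_solve_left)
  then have "(\<lambda>x. t \<otimes> x \<otimes> inv t) ` generate G K = generate G ((\<lambda>x. t \<otimes> x \<otimes> inv t) ` K)"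
    using K by (metis group_hom.generate_img)
  then show ?thesis by (auto simp: l_coset_def r_coset_def)
qed

lemma (in group) generate_insert_mult:
  assumes a: "a \<in> carrier G" and b: "b \<in> K" and K: "K \<subseteq> carrier G"
  shows "generate G (insert (a \<otimes> b) K) = generate G (insert a K)"
proof
  show "generate G (insert (a \<otimes> b) K) \<subseteq> generate G (insert a K)"
    using assms
    by (intro generate_subgroup_incl generate_is_subgroup) (auto intro: generate.incl generate.eng)
  have "a = (a \<otimes> b) \<otimes> inv b" using assms by (auto simp: m_assoc)
  also have "\<dots> \<in> generate G (insert (a \<otimes> b) K)"
    using b by (blast intro: generate.eng generate.incl generate.inv)
  finally show "generate G (insert a K) \<subseteq> generate G (insert (a \<otimes> b) K)"
    using assms by (intro generate_subgroup_incl generate_is_subgroup) (auto intro: generate.incl)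
qed

text \<open>The automorphism \<open>g\<close> of the overview, with \<open>b\<close> an arbitrary
  map on words; the recursion only passes to tails.\<close>

fun twist :: "(vertex \<Rightarrow> vertex) \<Rightarrow> nat \<Rightarrow> vertex \<Rightarrow> vertex" where
  "twist b k [] = []"
| "twist b k (False # w) = False # ((b \<circ> swapT) ^^ k) (twist b k w)"
| "twist b k (True # w) = True # twist b k w"

lemma twist_in_Aut:
  assumes b: "b \<in> carrier Aut_T"
  shows "twist b k \<in> carrier Aut_T"
proof (rule aut_of_bijI)
  let ?r = "(b \<circ> swapT) ^^ k"
  have "b \<circ> swapT \<in> carrier Aut_T"
    using monoid.m_closed[OF group.is_monoid[OF group_Aut_T] b swapT_in_Aut] by (simp add: Aut_T_def)
  then have r: "?r \<in> carrier Aut_T" by (rule Aut_T_funpow)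
  then have bij: "bij ?r" and root: "?r [] = []" by (auto simp: Aut_T_def tree_auts_def)
  have "twist b k u = twist b k v \<Longrightarrow> u = v" for u v
  proof (induction u arbitrary: v)
    case Nil
    then show ?case by (cases "(b, k, v)" rule: twist.cases) auto
  next
    case (Cons x u)
    then show ?case
      by (cases x; cases "(b, k, v)" rule: twist.cases) (auto dest: injD[OF bij_is_inj[OF bij]])
  qed
  moreover have "\<exists>u. twist b k u = v" for v
  \<comment> \<open>In the left subtree a preimage is needed for \<open>w'\<close>, the word that
    \<open>?r\<close> sends to the tail. It need not be a suffix of \<open>v\<close>, but it is
    shorter than \<open>v\<close>.\<close>
  proof (induction v rule: length_induct)
    case (1 v)
    show ?case
    proof (cases v)
      case Nil
      then show ?thesis by (metis twist.simps(1))
    next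
      case (Cons x w)
      obtain w' where w': "?r w' = w" using bij by (metis bij_pointE)
      then have "length w' = length w" using length_aut[OF r] by metis
      with 1 Cons obtain u u' where "twist b k u = w'" and "twist b k u' = w"
        by (metis length_Cons lessI)
      then have "twist b k (False # u) = False # w" and "twist b k (True # u') = True # w"
        by (simp_all add: w')
      with Cons show ?thesis by (metis (full_types))
    qed
  qed
  ultimately show "bij (twist b k)" by (metis bijI injI surjI)
  show "\<exists>y. twist b k (u @ [x]) = twist b k u @ [y]" for u x
  proof (induction u)
    case Nil
    show ?case by (cases x) (auto simp: root)
  next
    case (Cons z u)
    then obtain y where "twist b k (u @ [x]) = twist b k u @ [y]" ..
    then show ?case using aut_child[OF r, of "twist b k u" y] by (cases z) auto
  qed
qed simp

text \<open>The relation \<psi>(b) = (a, b) in pointwise form, together with the triviality of the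
  square of \<open>b\<close>. Below, \<open>p\<close> is \<open>ab\<close> and \<open>r\<close> is
  \<open>ba\<close>.\<close>

locale directed_involution =
  fixes b :: "vertex \<Rightarrow> vertex"
  assumes involution: "b (b w) = w"
    and b_False: "b (False # w) = False # swapT w"
    and b_True: "b (True # w) = True # b w"
begin

abbreviation "p \<equiv> swapT \<circ> b"
abbreviation "r \<equiv> b \<circ> swapT"

text \<open>Since \<open>a\<close> and \<open>b\<close> are involutions, \<open>ab\<close> and
  \<open>ba\<close> are mutually inverse.\<close>

lemma p_pow_r_pow: "(p ^^ k) ((r ^^ k) w) = w"
  by (induction k arbitrary: w) (simp_all add: funpow_swap1 involution swapT_swapT)

lemma r_pow_p_pow: "(r ^^ k) ((p ^^ k) w) = w"
  by (induction k arbitrary: w) (simp_all add: funpow_swap1 involution swapT_swapT)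

lemma swapT_r_pow: "swapT ((r ^^ k) w) = (p ^^ k) (swapT w)"
  by (induction k) simp_all

text \<open>A single \<open>p\<close> exchanges the two subtrees; its square preserves both and acts
  on the left one as \<open>ba\<close>, which halves the exponent.\<close>

lemma p_pow_double_False: "(p ^^ (2 * k)) (False # w) = False # (r ^^ k) w"
  by (induction k) (simp_all add: b_False b_True)

lemma p_pow_double_True: "(p ^^ (2 * k)) (True # w) = True # (p ^^ k) w"
  by (induction k) (simp_all add: b_False b_True)

text \<open>Comparing both sides on each subtree suffices, without induction: the factor
  \<open>r ^^ k\<close> in the left section of \<open>g\<close> is either produced or cancelled by
  the matching section of \<open>p ^^ (2 * k)\<close>.\<close>

lemma twist_swapT: "twist b k (swapT w) = (p ^^ (2 * k)) (swapT (twist b k w))"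
proof (cases "(b, k, w)" rule: twist.cases)
  case 1
  \<comment> \<open>A nonempty value \<open>b []\<close> would again have a nonempty image under
    \<open>b\<close>, but that image is \<open>[]\<close>.\<close>
  have "b [] = []"
    by (cases "b []"; cases "hd (b [])") (use involution[of "[]"] in \<open>auto simp: b_False b_True\<close>)
  then have "(p ^^ n) [] = []" for n by (induction n) auto
  with 1 show ?thesis by simp
qed (simp_all add: p_pow_double_False p_pow_double_True p_pow_r_pow)

lemma twist_actB: "twist b k (actB f v w) = actB f v (twist b k w)"
proof (induction f v w rule: actB.induct)
  case (2 f v w)
  \<comment> \<open>Half of the factor gained in moving \<open>a\<close> past \<open>g\<close>
    cancels against \<open>r ^^ k\<close>; the other half becomes \<open>r ^^ k\<close> again once
    \<open>a\<close> is moved to the front.\<close>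
  have "(r ^^ k) ((p ^^ (2 * k)) u) = (p ^^ k) u" for u
    by (simp add: mult_2 funpow_add r_pow_p_pow)
  then show ?case by (simp add: omega_def twist_swapT swapT_r_pow)
qed simp_all

end

theorem proposition4p3:
  fixes f :: "bit poly" and q :: nat and b :: "vertex \<Rightarrow> vertex"
  assumes "lead_coeff f = 1" and "degree f \<ge> 1" and "coeff f 0 \<noteq> 0"
    and "non_torsion Aut_T (sunic_group f)"
    and "q \<ge> 3" and "odd q"
    and "b \<in> imgB f" and "fixes_first_level b" and "psi b = (swapT, b)"
  shows "conjugate_in Aut_T
    (generate Aut_T (insert ((swapT \<otimes>\<^bsub>Aut_T\<^esub> b) [^]\<^bsub>Aut_T\<^esub> q) (imgB f)))
    (sunic_group f)"
proof -
  interpret group Aut_T by (rule group_Aut_T)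
  obtain k where q: "q = Suc (2 * k)" using \<open>odd q\<close> by (metis oddE Suc_eq_plus1)
  obtain v where v: "b = actB f v" using \<open>b \<in> imgB f\<close> by (auto simp: imgB_def)
  with \<open>psi b = (swapT, b)\<close> have "omega f v = swapT" and "actB f (rho f v) = actB f v"
    by (simp_all add: psi_actB)
  with v interpret directed_involution b by unfold_locales (simp_all add: actB_actB)
  have b: "b \<in> carrier Aut_T" by (simp add: v actB_in_Aut)
  have B: "imgB f \<subseteq> carrier Aut_T" by (auto simp: imgB_def actB_in_Aut)
  define g where "g = twist b k"
  \<comment> \<open>\<open>g\<close> conjugates the whole group onto the subgroup; the goal asks for
    the opposite direction.\<close>
  define t where "t = inv\<^bsub>Aut_T\<^esub> g"
  have g: "g \<in> carrier Aut_T" unfolding g_def using b by (rule twist_in_Aut)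
  then have t: "t \<in> carrier Aut_T" and inv_t: "inv\<^bsub>Aut_T\<^esub> t = g" by (simp_all add: t_def)
  let ?p = "swapT \<otimes>\<^bsub>Aut_T\<^esub> b"
  have pq: "?p [^]\<^bsub>Aut_T\<^esub> q \<in> carrier Aut_T" using b swapT_in_Aut by simp
  have conj: "t \<otimes>\<^bsub>Aut_T\<^esub> x \<otimes>\<^bsub>Aut_T\<^esub> inv\<^bsub>Aut_T\<^esub> t = y"
    if "g \<circ> y = x \<circ> g" "x \<in> carrier Aut_T" "y \<in> carrier Aut_T" for x y
  proof -
    have "x \<otimes>\<^bsub>Aut_T\<^esub> g = g \<otimes>\<^bsub>Aut_T\<^esub> y" using that(1) by (simp add: Aut_T_def)
    then show ?thesis using that g unfolding inv_t by (simp add: t_def m_assoc inv_solve_left')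
  qed
  have gB: "g \<circ> x = x \<circ> g" if "x \<in> imgB f" for x
    using that twist_actB by (auto simp: g_def imgB_def)
  have "g (p w) = (p ^^ q) (g w)" for w
  proof -
    \<comment> \<open>Passing \<open>a\<close> through \<open>g\<close> costs
      \<open>p ^^ (2 * k)\<close>, passing \<open>b\<close> costs nothing, and the remaining
      \<open>ab\<close> raises the exponent to \<open>q\<close>.\<close>
    have "g (p w) = (p ^^ (2 * k)) (swapT (g (b w)))" by (simp add: g_def twist_swapT)
    also have "g (b w) = b (g w)" using gB[OF \<open>b \<in> imgB f\<close>] by (rule comp_eq_dest)
    also have "(p ^^ (2 * k)) (swapT (b (g w))) = (p ^^ q) (g w)"
      by (simp add: q funpow_Suc_right del: funpow.simps(2))
    finally show ?thesis .
  qed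
  then have "g \<circ> ?p = (?p [^]\<^bsub>Aut_T\<^esub> q) \<circ> g"
    by (auto simp: Aut_T_pow) (auto simp: Aut_T_def)
  then have conj_p: "t \<otimes>\<^bsub>Aut_T\<^esub> (?p [^]\<^bsub>Aut_T\<^esub> q) \<otimes>\<^bsub>Aut_T\<^esub> inv\<^bsub>Aut_T\<^esub> t = ?p"
    using pq b swapT_in_Aut by (intro conj) simp_all
  have conj_B: "t \<otimes>\<^bsub>Aut_T\<^esub> x \<otimes>\<^bsub>Aut_T\<^esub> inv\<^bsub>Aut_T\<^esub> t = x" if "x \<in> imgB f" for x
    using that B by (intro conj gB) auto
  let ?S = "insert (?p [^]\<^bsub>Aut_T\<^esub> q) (imgB f)"
  have "t <#\<^bsub>Aut_T\<^esub> generate Aut_T ?S #>\<^bsub>Aut_T\<^esub> inv\<^bsub>Aut_T\<^esub> t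
      = generate Aut_T ((\<lambda>x. t \<otimes>\<^bsub>Aut_T\<^esub> x \<otimes>\<^bsub>Aut_T\<^esub> inv\<^bsub>Aut_T\<^esub> t) ` ?S)"
    using t pq B by (intro conjugate_generate) auto
  also have "(\<lambda>x. t \<otimes>\<^bsub>Aut_T\<^esub> x \<otimes>\<^bsub>Aut_T\<^esub> inv\<^bsub>Aut_T\<^esub> t) ` ?S = insert ?p (imgB f)"
    using conj_B by (simp add: conj_p)
  also have "generate Aut_T (insert ?p (imgB f)) = sunic_group f"
    unfolding sunic_group_def using swapT_in_Aut \<open>b \<in> imgB f\<close> B by (rule generate_insert_mult)
  finally show ?thesis unfolding conjugate_in_def using t by blast
qed

end
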